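(* Let $A$ be an invertible real $n\times n$ matrix, let $b,x_0\in\mathbb{R}^n$, and let $x_*=A^{-1}b$. Let $u_1,\ldots,u_q$ be an orthonormal basis (in $\mathbb{R}^n$) of the eigenspace of $R_A$ corresponding to the eigenvalue $-1$ ($q=0$ if $-1$ is not an eigenvalue). For $k\in\{0,1,\ldots,n-1\}$ and $j\in\{0,1\}$ let $$S_{kj}=\{x_*+R_k\cdots R_1R_A^{2i+j}(x_0-x_* ): i=0,1,2,\ldots\}.$$ Then the center of the minimal sphere supporting $S_{kj}$ is $$c_{kj}=(I_n-R_k\cdots R_1)x_*+R_k\cdots R_1c_j,$$ where $$c_j=x_0+\Big(I_n-(-1)^j\sum_{l=1}^q u_lu_l^{T}\Big)(x_*-x_0),\qquad j\in\{0,1\}.$$ Consequently, $c_{k0}+c_{k1}=2x_*$ for all $k=0,1,\ldots,n-1$.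
   Context: Let $A_i^{T}$ denote the $i$-th row of $A$ (so $A_i$ is a column vector), $R_i=I_n-2\frac{A_iA_i^{T}}{\|A_i\|^2}$, and $R_A=R_n\cdots R_2R_1$. When $k=0$, $R_k\cdots R_1$ is understood as the identity matrix. The norm is Euclidean. The minimal sphere supporting a set is the sphere of minimal dimension on which the set lies; here a sphere (of possibly lower dimension) in $\mathbb{R}^n$ is a set $\{x\in V:\|x-c\|=\rho\}$ with $V$ an affine subspace, center $c\in V$ and radius $\rho\ge0$ (a single point is the degenerate case $\rho=0$ with $V=\{c\}$). *)

theory Defs
  imports "HOL-Analysis.Analysis"
begin

definition outer :: "real^'n \<Rightarrow> real^'m \<Rightarrow> real^'m^'n" where
  "outer u v = (\<chi> i j. u $ i * v $ j)"

definition reflection_matrix :: "real^'n \<Rightarrow> real^'n^'n" where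
  "reflection_matrix a = mat 1 - (2 / (norm a)\<^sup>2) *\<^sub>R outer a a"

text \<open>The index type \<open>'n\<close> carries no order, so the numbering \<open>1, \<dots>, n\<close> of the rows, on which the order
  of the factors depends, is an argument: the \<open>i\<close>-th row of \<open>A\<close> is \<open>row (idx i) A\<close>.\<close>

primrec refl_prod :: "real^'n^'n \<Rightarrow> (nat \<Rightarrow> 'n) \<Rightarrow> nat \<Rightarrow> real^'n^'n" where
  "refl_prod A idx 0 = mat 1"
| "refl_prod A idx (Suc k) = reflection_matrix (row (idx (Suc k)) A) ** refl_prod A idx k"

definition R_full :: "real^'n^'n \<Rightarrow> (nat \<Rightarrow> 'n) \<Rightarrow> real^'n^'n" where
  "R_full A idx = refl_prod A idx CARD('n)"

text \<open>The operation \<open>^\<close> is not used because on \<open>real^'n^'n\<close> multiplication \<open>*\<close> is componentwise.\<close>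

definition matrix_power :: "real^'n^'n \<Rightarrow> nat \<Rightarrow> real^'n^'n" where
  "matrix_power M m = (((**) M) ^^ m) (mat 1)"

definition eigenspace :: "real^'n^'n \<Rightarrow> real \<Rightarrow> (real^'n) set" where
  "eigenspace M t = {v. M *v v = t *\<^sub>R v}"

definition orthonormal_basis :: "(nat \<Rightarrow> 'a::real_inner) \<Rightarrow> nat \<Rightarrow> 'a set \<Rightarrow> bool" where
  "orthonormal_basis u q E \<longleftrightarrow>
     (\<forall>l\<in>{1..q}. \<forall>m\<in>{1..q}. u l \<bullet> u m = (if l = m then 1 else 0)) \<and>
     span (u ` {1..q}) = E"

text \<open>A sphere, possibly of lower dimension, is \<open>sphere c r \<inter> V\<close> for an affine subspace \<open>V\<close> containing
  the center. Spheres are compared by \<open>aff_dim V\<close>, which is one more than the dimension of the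
  sphere when \<open>r > 0\<close>; a single point is then the case \<open>V = {c}\<close>, \<open>r = 0\<close>, ranked below
  the pairs of points (\<open>V\<close> a line).\<close>

definition supporting_sphere :: "'a::euclidean_space set \<Rightarrow> 'a set \<Rightarrow> 'a \<Rightarrow> real \<Rightarrow> bool" where
  "supporting_sphere S V c r \<longleftrightarrow> affine V \<and> c \<in> V \<and> 0 \<le> r \<and> S \<subseteq> sphere c r \<inter> V"

definition minimal_supporting_sphere :: "'a::euclidean_space set \<Rightarrow> 'a set \<Rightarrow> 'a \<Rightarrow> real \<Rightarrow> bool" where
  "minimal_supporting_sphere S V c r \<longleftrightarrow> supporting_sphere S V c r \<and>
     (\<forall>V' c' r'. supporting_sphere S V' c' r' \<longrightarrow> aff_dim V \<le> aff_dim V')"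

text \<open>The definite article is part of the claim: a minimal supporting sphere exists and is unique.\<close>

definition is_center_of_minimal_sphere :: "'a::euclidean_space \<Rightarrow> 'a set \<Rightarrow> bool" where
  "is_center_of_minimal_sphere c S \<longleftrightarrow> (\<exists>V r. minimal_supporting_sphere S V c r \<and>
     (\<forall>V' c' r'. minimal_supporting_sphere S V' c' r' \<longrightarrow> V' = V \<and> c' = c \<and> r' = r))"

definition S_set :: "real^'n^'n \<Rightarrow> (nat \<Rightarrow> 'n) \<Rightarrow> real^'n \<Rightarrow> real^'n \<Rightarrow> nat \<Rightarrow> nat \<Rightarrow> (real^'n) set" where
  "S_set A idx b x0 k j = (let xs = matrix_inv A *v b in
     {xs + (refl_prod A idx k ** matrix_power (R_full A idx) (2 * i + j)) *v (x0 - xs) | i. True})"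

definition c_base :: "real^'n^'n \<Rightarrow> real^'n \<Rightarrow> real^'n \<Rightarrow> (nat \<Rightarrow> real^'n) \<Rightarrow> nat \<Rightarrow> nat \<Rightarrow> real^'n" where
  "c_base A b x0 u q j = (let xs = matrix_inv A *v b in
     x0 + (mat 1 - (-1) ^ j *\<^sub>R (\<Sum>l = 1..q. outer (u l) (u l))) *v (xs - x0))"

definition c_center :: "real^'n^'n \<Rightarrow> (nat \<Rightarrow> 'n) \<Rightarrow> real^'n \<Rightarrow> real^'n \<Rightarrow> (nat \<Rightarrow> real^'n) \<Rightarrow> nat \<Rightarrow> nat \<Rightarrow> nat
    \<Rightarrow> real^'n" where
  "c_center A idx b x0 u q k j = (let xs = matrix_inv A *v b in
     (mat 1 - refl_prod A idx k) *v xs + refl_prod A idx k *v c_base A b x0 u q j)"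

end

theory Submission
  imports Defs
begin

text \<open>Write \<open>y = x\<^sub>0 - x\<^sub>*\<close> and let \<open>p\<close> be its projection to the eigenspace of \<open>R\<^sub>A\<close> for \<open>-1\<close>. The
  claimed center is \<open>x\<^sub>* + (-1)\<^sup>j R\<^sub>k \<cdots> R\<^sub>1 p\<close>, and it has the same distance to all points of the set
  because \<open>R\<^sub>A\<close> is orthogonal. A point equidistant to a set is the center of the minimal sphere as soon
  as it lies in the affine hull. The point \<open>d\<close> of the affine hull of \<open>{R\<^sub>A\<^sup>2\<^sup>i\<^sup>+\<^sup>j y}\<close> closest to the
  origin is fixed by the isometry \<open>R\<^sub>A\<^sup>2\<close>, which maps this hull to itself; since \<open>R\<^sub>A\<close> has no eigenvalue
  \<open>1\<close>, it follows that \<open>R\<^sub>A d = -d\<close>. All points of the hull have the same projection \<open>(-1)\<^sup>j p\<close> to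
  the eigenspace for \<open>-1\<close>, and therefore \<open>d = (-1)\<^sup>j p\<close>.\<close>

section \<open>Spheres and affine hulls\<close>

text \<open>Subtracting the two sphere equations cancels \<open>x \<bullet> x\<close>, so
  \<open>S\<close> and with it its affine hull lie in a hyperplane with normal
  \<open>c - c'\<close>. Both centers lie there too, hence \<open>c - c'\<close> is orthogonal to
  itself.\<close>

lemma equidistant_in_affine_hull_unique:
  fixes c c' :: "'a::euclidean_space"
  assumes "S \<subseteq> sphere c r" "S \<subseteq> sphere c' r'"
    and "c \<in> affine hull S" "c' \<in> affine hull S"
  shows "c = c'"
proof -
  define t where "t = (r'\<^sup>2 - r\<^sup>2 + c \<bullet> c - c' \<bullet> c') / 2"
  have "(c - c') \<bullet> x = t" if "x \<in> S" for x
  proof -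
    have "dist c x = r" "dist c' x = r'" using assms that by auto
    then have "(norm (c - x))\<^sup>2 = r\<^sup>2" "(norm (c' - x))\<^sup>2 = r'\<^sup>2" by (simp_all add: dist_norm)
    then have "(c - x) \<bullet> (c - x) = r\<^sup>2" "(c' - x) \<bullet> (c' - x) = r'\<^sup>2"
      by (simp_all add: power2_norm_eq_inner)
    moreover have "(z - x) \<bullet> (z - x) = z \<bullet> z - 2 * (z \<bullet> x) + x \<bullet> x" for z
      by (simp add: inner_diff_left inner_diff_right inner_commute)
    ultimately show ?thesis
      by (simp add: t_def inner_diff_left)
  qed
  then have "affine hull S \<subseteq> {x. (c - c') \<bullet> x = t}"
    by (intro hull_minimal) (auto simp: affine_hyperplane)
  then have "(c - c') \<bullet> c = t" "(c - c') \<bullet> c' = t" using assms by auto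
  then have "(c - c') \<bullet> (c - c') = 0" by (simp add: inner_diff_right)
  then show ?thesis by simp
qed

text \<open>The affine hull lies in the subspace of every supporting sphere, so it has least
  dimension, and a subspace of equal dimension coincides with it. A second center then lies in the
  hull as well.\<close>

lemma is_center_of_minimal_sphereI:
  fixes c :: "'a::euclidean_space"
  assumes "S \<noteq> {}" "S \<subseteq> sphere c r" "c \<in> affine hull S"
  shows "is_center_of_minimal_sphere c S"
  unfolding is_center_of_minimal_sphere_def
proof (intro exI conjI allI impI)
  let ?V = "affine hull S"
  have r: "0 \<le> r" using assms(1,2) by auto
  have hull_le: "?V \<subseteq> V'" if "supporting_sphere S V' c' r'" for V' c' r'
    using that by (auto simp: supporting_sphere_def intro: hull_minimal[THEN subsetD])
  have supp: "supporting_sphere S ?V c r"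
    using assms r hull_subset[of S affine] by (auto simp: supporting_sphere_def)
  then show "minimal_supporting_sphere S ?V c r"
    using hull_le by (auto simp: minimal_supporting_sphere_def simp del: aff_dim_affine_hull
        intro!: aff_dim_subset)
  fix V' c' r' assume "minimal_supporting_sphere S V' c' r'"
  then have s': "supporting_sphere S V' c' r'" and "aff_dim V' \<le> aff_dim ?V"
    using supp unfolding minimal_supporting_sphere_def by blast+
  then show V': "V' = ?V"
    using hull_le[OF s'] aff_dim_subset[OF hull_le[OF s']] assms(1)
    by (metis affine_affine_hull affine_dim_equal affine_hull_eq_empty order_antisym
        supporting_sphere_def)
  with s' have "S \<subseteq> sphere c' r'" "c' \<in> ?V" by (auto simp: supporting_sphere_def)
  then show c': "c' = c" using equidistant_in_affine_hull_unique assms by blast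
  show "r' = r" using \<open>S \<subseteq> sphere c' r'\<close> assms(1,2) c' by (auto simp: subset_iff)
qed

section \<open>Orbits of orthogonal transformations\<close>

lemma orthogonal_transformation_funpow:
  fixes f :: "'a::euclidean_space \<Rightarrow> 'a"
  assumes "orthogonal_transformation f"
  shows "orthogonal_transformation (f ^^ m)"
proof (induction m)
  case (Suc m)
  show ?case
    unfolding funpow.simps by (rule orthogonal_transformation_compose[OF assms Suc.IH])
qed (simp add: id_def orthogonal_transformation_id)

text \<open>The image of the point of least norm is again in the hull and has the same norm, and
  such a point is unique in a closed convex set.\<close>

lemma orthogonal_transformation_fixes_closest_point:
  fixes T :: "'a::euclidean_space \<Rightarrow> 'a"
  assumes T: "orthogonal_transformation T" and "T ` S \<subseteq> S" and "S \<noteq> {}"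
  shows "T (closest_point (affine hull S) 0) = closest_point (affine hull S) 0"
proof (rule closest_point_unique)
  let ?H = "affine hull S" and ?d = "closest_point (affine hull S) 0"
  have "?H \<noteq> {}" using assms(3) by simp
  then have d: "?d \<in> ?H" "\<And>z. z \<in> ?H \<Longrightarrow> norm ?d \<le> norm z"
    using closest_point_exists[of ?H 0] by auto
  have "T ` ?H = affine hull (T ` S)"
    using T by (simp add: affine_hull_linear_image orthogonal_transformation_linear
        linear_conv_bounded_linear[symmetric])
  also have "\<dots> \<subseteq> ?H" by (intro hull_mono assms)
  finally show "T ?d \<in> ?H" using d by auto
  show "\<forall>z\<in>?H. dist 0 (T ?d) \<le> dist 0 z"
    using d T by (simp add: orthogonal_transformation_norm)
qed (auto intro: affine_imp_convex)

lemma funpow_minus_eigenvector: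
  fixes f :: "'a::real_vector \<Rightarrow> 'a"
  assumes "linear f" "f p = - p"
  shows "(f ^^ m) p = (-1) ^ m *\<^sub>R p"
  by (induction m) (simp_all add: assms linear_cmul)

lemma minus_eigenvector_in_affine_hull_orbit:
  fixes f :: "'a::euclidean_space \<Rightarrow> 'a"
  assumes f: "orthogonal_transformation f"
    and no_fixed: "\<And>v. f v = v \<Longrightarrow> v = 0"
    and p: "f p = - p"
    and perp: "\<And>e. f e = - e \<Longrightarrow> (y - p) \<bullet> e = 0"
  shows "(-1) ^ j *\<^sub>R p \<in> affine hull (range (\<lambda>i. (f ^^ (2 * i + j)) y))"
proof -
  define S where "S = range (\<lambda>i. (f ^^ (2 * i + j)) y)"
  define d where "d = closest_point (affine hull S) 0"
  have lin: "linear f" using f by (rule orthogonal_transformation_linear)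
  have "S \<noteq> {}" by (simp add: S_def)
  then have d_in: "d \<in> affine hull S"
    unfolding d_def by (intro closest_point_in_set) auto
  have "(f ^^ 2) ` S \<subseteq> S"
  proof -
    have "(f ^^ 2) ((f ^^ (2 * i + j)) y) = (f ^^ (2 * Suc i + j)) y" for i
      by (simp add: numeral_2_eq_2)
    then show ?thesis unfolding S_def by blast
  qed
  then have "(f ^^ 2) d = d"
    unfolding d_def by (intro orthogonal_transformation_fixes_closest_point
        orthogonal_transformation_funpow f \<open>S \<noteq> {}\<close>)
  \<comment> \<open>\<open>f\<close> swaps \<open>d\<close> and \<open>f d\<close>, so it fixes
    their sum.\<close>
  then have "f (f d + d) = f d + d"
    using lin by (simp add: numeral_2_eq_2 linear_add add.commute)
  then have fd: "f d = - d" using no_fixed eq_neg_iff_add_eq_0 by blast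
  \<comment> \<open>The power of \<open>f\<close> that takes \<open>y\<close> to \<open>x\<close>
    preserves the orthogonality of \<open>y - p\<close> and \<open>e\<close>, and multiplies
    \<open>p\<close> and \<open>e\<close> by the sign \<open>(-1) ^ j\<close>, as its exponent has
    the parity of \<open>j\<close>.\<close>
  have S_perp: "(x - (-1) ^ j *\<^sub>R p) \<bullet> e = 0" if "f e = - e" and x_in: "x \<in> S" for e x
  proof -
    obtain i where x: "x = (f ^^ (2 * i + j)) y" using x_in unfolding S_def by blast
    let ?g = "f ^^ (2 * i + j)"
    have g: "orthogonal_transformation ?g" by (rule orthogonal_transformation_funpow[OF f])
    then have lin_g: "linear ?g" by (rule orthogonal_transformation_linear)
    have "?g p = (-1) ^ j *\<^sub>R p" and e: "?g e = (-1) ^ j *\<^sub>R e"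
      using funpow_minus_eigenvector[OF lin] p that by (simp_all add: power_add power_mult)
    then have "x - (-1) ^ j *\<^sub>R p = ?g (y - p)" by (simp add: x linear_diff[OF lin_g])
    moreover have "?g (y - p) \<bullet> ?g e = 0"
      using g perp that by (simp add: orthogonal_transformation_def)
    ultimately show ?thesis using e by simp
  qed
  let ?e = "d - (-1) ^ j *\<^sub>R p"
  have fe: "f ?e = - ?e" using lin by (simp add: linear_diff linear_cmul p fd)
  \<comment> \<open>The difference \<open>?e\<close> is itself an eigenvector for \<open>-1\<close>,
    so it may serve as the normal of a hyperplane through \<open>S\<close>. As \<open>d\<close> lies
    in that hyperplane, \<open>?e\<close> is orthogonal to itself.\<close>
  have "S \<subseteq> {x. ?e \<bullet> x = ?e \<bullet> ((-1) ^ j *\<^sub>R p)}"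
    using S_perp[OF fe] by (auto simp: inner_diff_left[of _ _ ?e] inner_commute[of ?e])
  then have "affine hull S \<subseteq> {x. ?e \<bullet> x = ?e \<bullet> ((-1) ^ j *\<^sub>R p)}"
    by (intro hull_minimal) (auto simp: affine_hyperplane)
  then have "?e \<bullet> ?e = 0" using d_in by (auto simp: inner_diff_right)
  then show ?thesis using d_in by (simp add: S_def)
qed

section \<open>Reflections and their products\<close>

lemma outer_mult_vec: "outer u v *v x = (v \<bullet> x) *\<^sub>R u"
  by (simp add: vec_eq_iff outer_def matrix_vector_mult_def inner_vec_def sum_distrib_left
      sum_distrib_right mult_ac)

lemma scaleR_mult_vec: "(c *\<^sub>R M) *v x = c *\<^sub>R (M *v x)" for M :: "real^'n^'m"
  by (simp add: scaleR_matrix_vector_assoc)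

lemma reflection_matrix_mult_vec:
  "reflection_matrix a *v x = x - (2 * (a \<bullet> x) / (norm a)\<^sup>2) *\<^sub>R a"
  by (simp add: reflection_matrix_def matrix_vector_mult_diff_rdistrib outer_mult_vec
      scaleR_mult_vec)

lemma orthogonal_transformation_reflection_matrix:
  "orthogonal_transformation ((*v) (reflection_matrix a))"
proof (cases "a = 0")
  case False
  have "norm (reflection_matrix a *v x) = norm x" for x
    unfolding norm_eq reflection_matrix_mult_vec power2_norm_eq_inner using False
    by (simp add: inner_diff_left inner_diff_right inner_commute field_simps)
  then show ?thesis
    by (simp add: orthogonal_transformation)
next
  \<comment> \<open>The degenerate matrix is the identity, whatever value the division by zero
    takes.\<close>
  case True
  then have "(*v) (reflection_matrix a) = (\<lambda>x. x)"
    by (simp add: fun_eq_iff reflection_matrix_mult_vec)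
  then show ?thesis by (simp add: orthogonal_transformation_id)
qed

lemma orthogonal_transformation_refl_prod:
  "orthogonal_transformation ((*v) (refl_prod A idx k))"
proof (induction k)
  case (Suc k)
  show ?case
    using orthogonal_transformation_compose[OF
        orthogonal_transformation_reflection_matrix Suc.IH]
    by (simp add: o_def matrix_vector_mul_assoc)
qed (simp add: orthogonal_transformation_id[unfolded id_def])

lemma matrix_power_mult_vec: "matrix_power M m *v x = (((*v) M) ^^ m) x"
  unfolding matrix_power_def
  by (induction m) (simp_all add: matrix_vector_mul_assoc[symmetric])

text \<open>If \<open>R\<^sub>A v = v\<close>, then the increments \<open>t\<^sub>k A\<^sub>k\<close> of the successive reflections sum to zero, and
  all \<open>t\<^sub>k\<close> vanish by the independence of the rows. So every reflection fixes \<open>v\<close>, i.e. \<open>A v = 0\<close>.\<close>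

lemma R_full_no_fixed_vector:
  fixes A :: "real^'n^'n" and idx :: "nat \<Rightarrow> 'n"
  assumes "invertible A" and idx: "bij_betw idx {1..CARD('n)} UNIV"
    and fixed: "R_full A idx *v v = v"
  shows "v = 0"
proof -
  define a where "a k = row (idx k) A" for k
  define w where "w k = refl_prod A idx k *v v" for k
  define t where "t k = 2 * (a k \<bullet> w (k - 1)) / (norm (a k))\<^sup>2" for k
  \<comment> \<open>The coefficients are carried from the numbering over to the index type, so that
    their combination of the rows becomes \<open>transpose A *v s\<close>.\<close>
  define s where "s = (\<chi> i. t (inv_into {1..CARD('n)} idx i))"
  have step: "w (Suc k) = w k - t (Suc k) *\<^sub>R a (Suc k)" for k
    by (simp add: w_def t_def a_def matrix_vector_mul_assoc[symmetric] reflection_matrix_mult_vec)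
  have w: "w k = v - (\<Sum>i=1..k. t i *\<^sub>R a i)" for k
  proof (induction k)
    case 0 then show ?case by (simp add: w_def)
  next
    case (Suc k) then show ?case by (simp add: step)
  qed
  have s_idx: "s $ idx k = t k" if "k \<in> {1..CARD('n)}" for k
    using that idx by (simp add: s_def bij_betw_def inv_into_f_f)
  have "0 = (\<Sum>i=1..CARD('n). t i *\<^sub>R a i)"
    using w[of "CARD('n)"] fixed by (simp add: w_def R_full_def)
  also have "\<dots> = (\<Sum>i=1..CARD('n). s $ idx i *\<^sub>R row (idx i) A)"
    by (intro sum.cong) (auto simp: s_idx a_def)
  also have "\<dots> = (\<Sum>i\<in>UNIV. s $ i *\<^sub>R row i A)"
    by (rule sum.reindex_bij_betw[OF idx])
  also have "\<dots> = transpose A *v s"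
    by (simp add: vec_eq_iff matrix_vector_mult_def transpose_def row_def mult.commute)
  finally have "s = 0"
    using transpose_invertible[OF assms(1)] by (metis inj_matrix_vector_mult injD
        matrix_vector_mult_0_right)
  then have t0: "t k = 0" if "k \<in> {1..CARD('n)}" for k using s_idx[OF that] by simp
  have "row i A \<bullet> v = 0" for i
  proof -
    obtain k where k: "k \<in> {1..CARD('n)}" "idx k = i"
      using idx by (metis bij_betw_imp_surj_on imageE UNIV_I)
    \<comment> \<open>With all earlier increments zero, \<open>v\<close> reaches the
      \<open>k\<close>-th reflection unchanged, and \<open>t k = 0\<close> then says that this row
      is orthogonal to \<open>v\<close>.\<close>
    have "w (k - 1) = v" unfolding w using k(1) t0 by (subst sum.neutral) auto
    then show ?thesis using t0[OF k(1)] k by (auto simp: t_def a_def)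
  qed
  then have "A *v v = 0"
    by (simp add: vec_eq_iff matrix_vector_mul_component row_def vec_lambda_eta)
  then show ?thesis
    using assms(1) by (metis inj_matrix_vector_mult injD matrix_vector_mult_0_right)
qed

section \<open>Projection to the eigenspace and the centers\<close>

lemma orthonormal_basis_projection:
  fixes u :: "nat \<Rightarrow> real^'n"
  assumes "orthonormal_basis u q E"
  defines "P \<equiv> \<Sum>l=1..q. outer (u l) (u l)"
  shows "P *v y \<in> E" and "e \<in> E \<Longrightarrow> (y - P *v y) \<bullet> e = 0"
proof -
  have on: "\<And>l m. l \<in> {1..q} \<Longrightarrow> m \<in> {1..q} \<Longrightarrow> u l \<bullet> u m = (if l = m then 1 else 0)"
    and E: "span (u ` {1..q}) = E"
    using assms by (auto simp: orthonormal_basis_def)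
  have "P *v y = (\<Sum>l=1..q. outer (u l) (u l) *v y)"
    unfolding P_def by (induction q) (simp_all add: matrix_vector_mult_add_rdistrib)
  then have P: "P *v y = (\<Sum>l=1..q. (u l \<bullet> y) *\<^sub>R u l)" by (simp add: outer_mult_vec)
  show "P *v y \<in> E"
    unfolding P E[symmetric] by (intro span_sum span_scale span_base) auto
  assume "e \<in> E"
  have "orthogonal (y - P *v y) (u m)" if "m \<in> {1..q}" for m
  proof -
    have "(\<Sum>l=1..q. (u l \<bullet> y) * (u l \<bullet> u m)) = (\<Sum>l=1..q. if l = m then u m \<bullet> y else 0)"
      using on that by (intro sum.cong) auto
    then show ?thesis using that
      by (simp add: P orthogonal_def inner_diff_left inner_sum_left)
        (simp add: inner_commute[of y])
  qed
  then show "(y - P *v y) \<bullet> e = 0"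
    unfolding orthogonal_def[symmetric] using \<open>e \<in> E\<close> E
    by (intro orthogonal_to_span[of e "u ` {1..q}"]) auto
qed

text \<open>In this form the centers for \<open>j = 0\<close> and \<open>j = 1\<close> are visibly
  symmetric about \<open>xs\<close>, which gives the last claim of the theorem.\<close>

lemma c_center_eq:
  fixes A :: "real^'n^'n" and b x0 :: "real^'n"
  defines "xs \<equiv> matrix_inv A *v b"
  shows "c_center A idx b x0 u q k j =
    xs + refl_prod A idx k *v ((-1) ^ j *\<^sub>R ((\<Sum>l=1..q. outer (u l) (u l)) *v (x0 - xs)))"
  unfolding c_center_def c_base_def Let_def xs_def[symmetric]
  by (simp add: matrix_vector_mult_diff_rdistrib scaleR_mult_vec matrix_vector_right_distrib
      matrix_vector_mult_diff_distrib algebra_simps)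

theorem corollary8:
  fixes A :: "real^'n^'n" and b x0 :: "real^'n"
    and idx :: "nat \<Rightarrow> 'n" and u :: "nat \<Rightarrow> real^'n" and q :: nat
  assumes "invertible A"
    and "bij_betw idx {1..CARD('n)} UNIV"
    and "orthonormal_basis u q (eigenspace (R_full A idx) (-1))"
  shows "(\<forall>k<CARD('n). \<forall>j\<in>{0, 1}.
            is_center_of_minimal_sphere (c_center A idx b x0 u q k j) (S_set A idx b x0 k j))
       \<and> (\<forall>k<CARD('n). c_center A idx b x0 u q k 0 + c_center A idx b x0 u q k 1
            = 2 *\<^sub>R (matrix_inv A *v b))"
proof (intro conjI allI impI ballI)
  define xs where "xs = matrix_inv A *v b"
  define y where "y = x0 - xs"
  define p where "p = (\<Sum>l=1..q. outer (u l) (u l)) *v y"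
  define f where "f = (*v) (R_full A idx)"
  have f: "orthogonal_transformation f"
    unfolding f_def R_full_def by (rule orthogonal_transformation_refl_prod)
  have lin: "linear f" using f by (rule orthogonal_transformation_linear)
  have E: "e \<in> eigenspace (R_full A idx) (-1) \<longleftrightarrow> f e = - e" for e
    by (simp add: eigenspace_def f_def)
  note proj = orthonormal_basis_projection[OF assms(3), where y = y, unfolded E, folded p_def]
  fix k :: nat
  define g where "g = (*v) (refl_prod A idx k)"
  have g: "orthogonal_transformation g"
    unfolding g_def by (rule orthogonal_transformation_refl_prod)
  have lin_g: "linear g" using g by (rule orthogonal_transformation_linear)
  have center: "c_center A idx b x0 u q k j = xs + g ((-1) ^ j *\<^sub>R p)" for j
    by (simp add: c_center_eq xs_def[symmetric] y_def[symmetric] p_def g_def)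
  show "c_center A idx b x0 u q k 0 + c_center A idx b x0 u q k 1 = 2 *\<^sub>R (matrix_inv A *v b)"
    unfolding center xs_def[symmetric] by (simp add: linear_neg[OF lin_g] scaleR_2)
  fix j :: nat
  define Y where "Y = range (\<lambda>i. (f ^^ (2 * i + j)) y)"
  have S: "S_set A idx b x0 k j = (+) xs ` g ` Y"
    by (auto simp: S_set_def Let_def Y_def f_def g_def xs_def y_def matrix_power_mult_vec
        matrix_vector_mul_assoc[symmetric] image_image)
  show "is_center_of_minimal_sphere (c_center A idx b x0 u q k j) (S_set A idx b x0 k j)"
  proof (rule is_center_of_minimal_sphereI)
    show "S_set A idx b x0 k j \<noteq> {}" by (simp add: S Y_def)
    have "affine hull (g ` Y) = g ` (affine hull Y)"
      by (simp add: affine_hull_linear_image lin_g linear_conv_bounded_linear[symmetric])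
    moreover have "(-1) ^ j *\<^sub>R p \<in> affine hull Y"
      unfolding Y_def using assms proj
      by (intro minus_eigenvector_in_affine_hull_orbit f)
        (auto simp: f_def intro: R_full_no_fixed_vector)
    ultimately show "c_center A idx b x0 u q k j \<in> affine hull (S_set A idx b x0 k j)"
      unfolding S center affine_hull_translation by blast
    \<comment> \<open>The radius is the same for all \<open>k\<close> and \<open>j\<close>: each
      difference between the center and a point of the set is the image of \<open>p - y\<close>
      under an isometry.\<close>
    show "S_set A idx b x0 k j \<subseteq> sphere (c_center A idx b x0 u q k j) (norm (p - y))"
    proof -
      have "norm (g ((-1) ^ j *\<^sub>R p) - g ((f ^^ (2 * i + j)) y)) = norm (p - y)" for i
      proof -
        have h: "orthogonal_transformation (f ^^ (2 * i + j))" (is "orthogonal_transformation ?h")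
          by (rule orthogonal_transformation_funpow[OF f])
        have "?h p = (-1) ^ j *\<^sub>R p"
          using funpow_minus_eigenvector[OF lin proj(1)] by (simp add: power_add power_mult)
        then have "g ((-1) ^ j *\<^sub>R p) - g (?h y) = g (?h (p - y))"
          using linear_diff[OF lin_g] linear_diff[OF orthogonal_transformation_linear[OF h]]
          by simp
        then show ?thesis using g h by (simp add: orthogonal_transformation_norm)
      qed
      then show ?thesis by (auto simp: S center Y_def dist_norm)
    qed
  qed
qed

end
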